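(* Let $(\mathcal A,[\cdot_\lambda\cdot],\mathfrak B)$ be a Rota-Baxter Lie conformal algebra of weight $1$. Define a $\mathbf k$-bilinear map $\cdot_\lambda\cdot:\mathcal A\times\mathcal A\to\mathcal A[\lambda]$ by $$a_\lambda b=[\mathfrak B(a)_\lambda b],\qquad\forall a,b\in\mathcal A.$$ Then $(\mathcal A,[\cdot_\lambda\cdot],\cdot_\lambda\cdot)$ is a post-Lie conformal algebra. Furthermore, if there is a non-degenerate symmetric invariant conformal bilinear form $\omega_\lambda(\cdot,\cdot)$ on the Lie conformal algebra $(\mathcal A,[\cdot_\lambda\cdot])$, then $(\mathcal A,[\cdot_\lambda\cdot],\cdot_\lambda\cdot,\omega_\lambda(\cdot,\cdot))$ is a generalized pseudo-Hessian post-Lie conformal algebra.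
   Context: $\mathbf k$ is a field of characteristic zero; all $\mathbf k[\partial]$-modules are finitely generated. Subscripts containing $\partial$ mean that the variable is replaced by the operator acting from the left on the coefficients. A Lie conformal algebra is a $\mathbf k[\partial]$-module $\mathcal A$ with a $\mathbf k$-bilinear map $[\cdot_\lambda\cdot]:\mathcal A\times\mathcal A\to\mathcal A[\lambda]$ such that $[\partial a_\lambda b]=-\lambda[a_\lambda b]$, $[a_\lambda\partial b]=(\lambda+\partial)[a_\lambda b]$ (conformal sesquilinearity), $[a_\lambda b]=-[b_{-\lambda-\partial}a]$, $[a_\lambda[b_\mu c]]=[[a_\lambda b]_{\lambda+\mu}c]+[b_\mu[a_\lambda c]]$. It is a Rota-Baxter Lie conformal algebra of weight $\theta$ when equipped with a $\mathbf k[\partial]$-module homomorphism $\mathfrak B:\mathcal A\to\mathcal A$ with $[\mathfrak B(a)_\lambda\mathfrak B(b)]=\mathfrak B([\mathfrak B(a)_\lambda b]+[a_\lambda\mathfrak B(b)]+\theta[a_\lambda b])$. A conformal bilinear form on $\mathcal A$ is a $\mathbf k$-bilinear map $\omega_\lambda:\mathcal A\times\mathcal A\to\mathbf k[\lambda]$ with $\omega_\lambda(\partial a,b)=-\lambda\omega_\lambda(a,b)$, $\omega_\lambda(a,\partial b)=\lambda\omega_\lambda(a,b)$; symmetric: $\omega_\lambda(a,b)=\omega_{-\lambda}(b,a)$; invariant on the Lie conformal algebra: $\omega_\lambda([a_\mu b],c)=\omega_\mu(a,[b_{\lambda-\mu}c])$; non-degenerate: $a\mapsto\omega_\lambda(a,\cdot)$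 is a $\mathbf k[\partial]$-module isomorphism from $\mathcal A$ onto $\mathcal A^{*c}$, the module of $\mathbf k$-linear maps $f:\mathcal A\to\mathbf k[\lambda]$ with $f_\lambda(\partial a)=\lambda f_\lambda a$ and $(\partial f)_\lambda=-\lambda f_\lambda$. A post-Lie conformal algebra $(\mathcal A,[\cdot_\lambda\cdot],\cdot_\lambda\cdot)$ is a Lie conformal algebra with a $\mathbf k$-bilinear $\cdot_\lambda\cdot:\mathcal A\times\mathcal A\to\mathcal A[\lambda]$ satisfying conformal sesquilinearity and $$(a_\lambda b)_{\lambda+\mu}c-(b_\mu a)_{\lambda+\mu}c+[a_\lambda b]_{\lambda+\mu}c+b_\mu(a_\lambda c)-a_\lambda(b_\mu c)=0,\qquad a_\lambda[b_\mu c]=[(a_\lambda b)_{\lambda+\mu}c]+[b_\mu(a_\lambda c)].$$ A conformal bilinear form on it is invariant if $\omega_\lambda([a_\mu b],c)=\omega_\mu(a,[b_{\lambda-\mu}c])$ and $\omega_{\lambda+\mu}(a_\lambda b,c)-\omega_\lambda(a,b_\mu c)=\omega_{\lambda+\mu}(b_\mu a,c)-\omega_\mu(b,a_\lambda c)$ for all $a,b,c$. A generalized pseudo-Hessian post-Lie conformal algebra is a post-Lie conformal algebra with a non-degenerate symmetric invariant conformal bilinear form. *)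

theory Defs
  imports
    "HOL-Computational_Algebra.Polynomial"
    "HOL-Library.Function_Algebras"
begin

(* Encoding.
   k[\<partial>] is 'k poly; a k[\<partial>]-module is an abelian group 'a with an action
   scale :: 'k poly => 'a => 'a, so that c in k acts as scale [:c:] and \<partial> as scale [:0, 1:].
   A[\<lambda>] is 'a poly, and A[\<lambda>,\<mu>] is 'a poly poly, with \<lambda> the inner and \<mu> the outer variable.
   A \<lambda>-product a_\<lambda> b is a function f :: 'a => 'a => 'a poly. *)

text \<open>The action of R[x] on M[x] induced by an action of R on M.\<close>

definition poly_scale ::
  "('r::zero \<Rightarrow> 'm::comm_monoid_add \<Rightarrow> 'm) \<Rightarrow> 'r poly \<Rightarrow> 'm poly \<Rightarrow> 'm poly" where
  "poly_scale s P q =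
     (\<Sum>i\<le>degree P. \<Sum>j\<le>degree q. monom (s (coeff P i) (coeff q j)) (i + j))"

text \<open>The k-action underlying a k[\<partial>]-module, and the induced action of k[\<lambda>,\<mu>] on A[\<lambda>,\<mu>].\<close>

definition const_scale ::
  "('k::comm_ring_1 poly \<Rightarrow> 'a \<Rightarrow> 'a) \<Rightarrow> 'k \<Rightarrow> 'a \<Rightarrow> 'a" where
  "const_scale scale c = scale [:c:]"

definition scale2 ::
  "('k::comm_ring_1 poly \<Rightarrow> 'a::ab_group_add \<Rightarrow> 'a) \<Rightarrow> 'k poly poly \<Rightarrow> 'a poly poly \<Rightarrow> 'a poly poly" where
  "scale2 scale = poly_scale (poly_scale (const_scale scale))"

text \<open>The variables of k[\<lambda>,\<mu>].\<close>

definition lam :: "'k::comm_ring_1 poly poly" where "lam = [:[:0, 1:]:]"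
definition mu :: "'k::comm_ring_1 poly poly" where "mu = [:0, 1:]"

text \<open>The variables of k[\<partial>][\<lambda>], which acts on A[\<lambda>] via \<open>poly_scale scale\<close>.
  The operator \<open>\<partial>\<close> acts on the coefficients.\<close>

definition lam1 :: "'k::comm_ring_1 poly poly" where "lam1 = [:0, 1:]"
definition del1 :: "'k::comm_ring_1 poly poly" where "del1 = [:[:0, 1:]:]"

text \<open>The elements of A viewed in A[\<lambda>,\<mu>].\<close>

abbreviation cst :: "'a::zero \<Rightarrow> 'a poly poly" where "cst a \<equiv> [:[:a:]:]"

text \<open>Substituting the operator \<open>L\<close> for the variable, \<open>L\<close> acting from the left on the
  coefficients: \<open>\<Sum>\<^sub>n x\<^sup>n p\<^sub>n\<close> becomes \<open>\<Sum>\<^sub>n L\<^sup>n p\<^sub>n\<close>. In \<open>subst_op\<close> the result is in A[\<lambda>] and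
  \<open>L\<close> is in k[\<partial>][\<lambda>]; in \<open>subst2\<close> the result is in M[\<lambda>,\<mu>], on which k[\<lambda>,\<mu>] acts by \<open>act\<close>.\<close>

definition subst_op ::
  "('k::comm_ring_1 poly \<Rightarrow> 'a::ab_group_add \<Rightarrow> 'a) \<Rightarrow> 'k poly poly \<Rightarrow> 'a poly \<Rightarrow> 'a poly" where
  "subst_op scale L p = (\<Sum>n\<le>degree p. poly_scale scale (L ^ n) [:coeff p n:])"

definition subst2 ::
  "('k::comm_ring_1 poly poly \<Rightarrow> 'm::ab_group_add poly poly \<Rightarrow> 'm poly poly) \<Rightarrow>
   'k poly poly \<Rightarrow> 'm poly \<Rightarrow> 'm poly poly" where
  "subst2 act L p = (\<Sum>n\<le>degree p. act (L ^ n) (cst (coeff p n)))"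

text \<open>The k[\<lambda>,\<mu>]-linear extension to A[\<lambda>,\<mu>] of a k-linear map g from A to M[\<lambda>,\<mu>].\<close>

definition lin_ext2 ::
  "('k::comm_ring_1 poly poly \<Rightarrow> 'm::ab_group_add poly poly \<Rightarrow> 'm poly poly) \<Rightarrow>
   ('a::zero \<Rightarrow> 'm poly poly) \<Rightarrow> 'a poly poly \<Rightarrow> 'm poly poly" where
  "lin_ext2 act g u =
     (\<Sum>j\<le>degree u. \<Sum>i\<le>degree (coeff u j). act (lam ^ i * mu ^ j) (g (coeff (coeff u j) i)))"

text \<open>\<open>ext2 act f L u v\<close> is \<open>f\<^sub>L(u, v)\<close> for \<open>u\<close>, \<open>v\<close> in A[\<lambda>,\<mu>] and \<open>L\<close> in k[\<lambda>,\<mu>], where the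
  k-bilinear map f from A \<times> A to M[x] is extended k[\<lambda>,\<mu>]-bilinearly and \<open>L\<close> is put for x.\<close>

definition ext2 ::
  "('k::comm_ring_1 poly poly \<Rightarrow> 'm::ab_group_add poly poly \<Rightarrow> 'm poly poly) \<Rightarrow>
   ('a::zero \<Rightarrow> 'a \<Rightarrow> 'm poly) \<Rightarrow> 'k poly poly \<Rightarrow> 'a poly poly \<Rightarrow> 'a poly poly \<Rightarrow> 'm poly poly" where
  "ext2 act f L u v = lin_ext2 act (\<lambda>a. lin_ext2 act (\<lambda>b. subst2 act L (f a b)) v) u"

abbreviation ext_prod ::
  "('k::comm_ring_1 poly \<Rightarrow> 'a::ab_group_add \<Rightarrow> 'a) \<Rightarrow> ('a \<Rightarrow> 'a \<Rightarrow> 'a poly) \<Rightarrow>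
   'k poly poly \<Rightarrow> 'a poly poly \<Rightarrow> 'a poly poly \<Rightarrow> 'a poly poly" where
  "ext_prod scale f \<equiv> ext2 (scale2 scale) f"

abbreviation ext_form ::
  "('a::zero \<Rightarrow> 'a \<Rightarrow> 'k::comm_ring_1 poly) \<Rightarrow>
   'k poly poly \<Rightarrow> 'a poly poly \<Rightarrow> 'a poly poly \<Rightarrow> 'k poly poly" where
  "ext_form \<omega> \<equiv> ext2 (*) \<omega>"

definition k_bilinear ::
  "('k::field \<Rightarrow> 'a::ab_group_add \<Rightarrow> 'a) \<Rightarrow> ('k \<Rightarrow> 'm::ab_group_add \<Rightarrow> 'm) \<Rightarrow> ('a \<Rightarrow> 'a \<Rightarrow> 'm) \<Rightarrow> bool" where
  "k_bilinear s1 s2 f \<longleftrightarrow>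
     (\<forall>b. Vector_Spaces.linear s1 s2 (\<lambda>a. f a b)) \<and> (\<forall>a. Vector_Spaces.linear s1 s2 (f a))"

locale fg_del_module =
  module scale
  for scale :: "'k::field_char_0 poly \<Rightarrow> 'a::ab_group_add \<Rightarrow> 'a" +
  assumes finitely_generated: "\<exists>S. finite S \<and> span S = UNIV"

locale conformal_product =
  fg_del_module scale
  for scale :: "'k::field_char_0 poly \<Rightarrow> 'a::ab_group_add \<Rightarrow> 'a" +
  fixes f :: "'a \<Rightarrow> 'a \<Rightarrow> 'a poly"
  assumes bilinear:
      "k_bilinear (const_scale scale) (\<lambda>c. map_poly (const_scale scale c)) f"
    and sesquilinear_left:
      "f (scale [:0, 1:] a) b = poly_scale scale (- lam1) (f a b)"
    and sesquilinear_right: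
      "f a (scale [:0, 1:] b) = poly_scale scale (lam1 + del1) (f a b)"

locale lie_conformal_algebra =
  conformal_product scale br
  for scale :: "'k::field_char_0 poly \<Rightarrow> 'a::ab_group_add \<Rightarrow> 'a"
    and br :: "'a \<Rightarrow> 'a \<Rightarrow> 'a poly" +
  assumes skew_symmetry:
      "br a b = - subst_op scale (- lam1 - del1) (br b a)"
    and jacobi:
      "ext_prod scale br lam (cst a) (ext_prod scale br mu (cst b) (cst c)) =
         ext_prod scale br (lam + mu) (ext_prod scale br lam (cst a) (cst b)) (cst c)
         + ext_prod scale br mu (cst b) (ext_prod scale br lam (cst a) (cst c))"

locale rota_baxter_lie_conformal_algebra =
  lie_conformal_algebra scale br
  for scale :: "'k::field_char_0 poly \<Rightarrow> 'a::ab_group_add \<Rightarrow> 'a"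
    and br :: "'a \<Rightarrow> 'a \<Rightarrow> 'a poly" +
  fixes \<theta> :: 'k and B :: "'a \<Rightarrow> 'a"
  assumes B_hom: "module_hom scale scale B"
    and rota_baxter:
      "br (B a) (B b) =
         map_poly B (br (B a) b + br a (B b) + map_poly (const_scale scale \<theta>) (br a b))"

locale post_lie_conformal_algebra =
  lie_conformal_algebra scale br + dot: conformal_product scale dot
  for scale :: "'k::field_char_0 poly \<Rightarrow> 'a::ab_group_add \<Rightarrow> 'a"
    and br :: "'a \<Rightarrow> 'a \<Rightarrow> 'a poly"
    and dot :: "'a \<Rightarrow> 'a \<Rightarrow> 'a poly" +
  assumes post_lie_1:
      "ext_prod scale dot (lam + mu) (ext_prod scale dot lam (cst a) (cst b)) (cst c)
       - ext_prod scale dot (lam + mu) (ext_prod scale dot mu (cst b) (cst a)) (cst c)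
       + ext_prod scale dot (lam + mu) (ext_prod scale br lam (cst a) (cst b)) (cst c)
       + ext_prod scale dot mu (cst b) (ext_prod scale dot lam (cst a) (cst c))
       - ext_prod scale dot lam (cst a) (ext_prod scale dot mu (cst b) (cst c)) = 0"
    and post_lie_2:
      "ext_prod scale dot lam (cst a) (ext_prod scale br mu (cst b) (cst c)) =
         ext_prod scale br (lam + mu) (ext_prod scale dot lam (cst a) (cst b)) (cst c)
         + ext_prod scale br mu (cst b) (ext_prod scale dot lam (cst a) (cst c))"

locale conformal_form =
  fg_del_module scale
  for scale :: "'k::field_char_0 poly \<Rightarrow> 'a::ab_group_add \<Rightarrow> 'a" +
  fixes \<omega> :: "'a \<Rightarrow> 'a \<Rightarrow> 'k poly"
  assumes form_bilinear: "k_bilinear (const_scale scale) smult \<omega>"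
    and form_left: "\<omega> (scale [:0, 1:] a) b = - [:0, 1:] * \<omega> a b"
    and form_right: "\<omega> a (scale [:0, 1:] b) = [:0, 1:] * \<omega> a b"

definition form_symmetric :: "('a \<Rightarrow> 'a \<Rightarrow> 'k::comm_ring_1 poly) \<Rightarrow> bool" where
  "form_symmetric \<omega> \<longleftrightarrow> (\<forall>a b. \<omega> a b = pcompose (\<omega> b a) (- [:0, 1:]))"

definition lie_invariant ::
  "('k::comm_ring_1 poly \<Rightarrow> 'a::ab_group_add \<Rightarrow> 'a) \<Rightarrow> ('a \<Rightarrow> 'a \<Rightarrow> 'a poly) \<Rightarrow>
   ('a \<Rightarrow> 'a \<Rightarrow> 'k poly) \<Rightarrow> bool" where
  "lie_invariant scale br \<omega> \<longleftrightarrow>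
     (\<forall>a b c. ext_form \<omega> lam (ext_prod scale br mu (cst a) (cst b)) (cst c) =
              ext_form \<omega> mu (cst a) (ext_prod scale br (lam - mu) (cst b) (cst c)))"

definition post_lie_invariant ::
  "('k::comm_ring_1 poly \<Rightarrow> 'a::ab_group_add \<Rightarrow> 'a) \<Rightarrow> ('a \<Rightarrow> 'a \<Rightarrow> 'a poly) \<Rightarrow>
   ('a \<Rightarrow> 'a \<Rightarrow> 'a poly) \<Rightarrow> ('a \<Rightarrow> 'a \<Rightarrow> 'k poly) \<Rightarrow> bool" where
  "post_lie_invariant scale br dot \<omega> \<longleftrightarrow>
     lie_invariant scale br \<omega> \<and>
     (\<forall>a b c.
        ext_form \<omega> (lam + mu) (ext_prod scale dot lam (cst a) (cst b)) (cst c)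
        - ext_form \<omega> lam (cst a) (ext_prod scale dot mu (cst b) (cst c)) =
        ext_form \<omega> (lam + mu) (ext_prod scale dot mu (cst b) (cst a)) (cst c)
        - ext_form \<omega> mu (cst b) (ext_prod scale dot lam (cst a) (cst c)))"

text \<open>The conformal dual of A, a submodule of the k[\<partial>]-module of all functions from A to k[\<lambda>],
  on which \<open>(P(\<partial>) f)\<^sub>\<lambda> = P(-\<lambda>) f\<^sub>\<lambda>\<close>, that is, \<open>\<partial>\<close> acts as multiplication by \<open>-\<lambda>\<close>.\<close>

definition conformal_dual ::
  "('k::field poly \<Rightarrow> 'a::ab_group_add \<Rightarrow> 'a) \<Rightarrow> ('a \<Rightarrow> 'k poly) set" where
  "conformal_dual scale =
     {f. Vector_Spaces.linear (const_scale scale) smult f \<and>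
         (\<forall>a. f (scale [:0, 1:] a) = [:0, 1:] * f a)}"

definition dual_scale :: "'k::comm_ring_1 poly \<Rightarrow> ('a \<Rightarrow> 'k poly) \<Rightarrow> 'a \<Rightarrow> 'k poly" where
  "dual_scale P f = (\<lambda>a. pcompose P (- [:0, 1:]) * f a)"

text \<open>\<open>\<omega>\<close> is curried, so it is itself the map taking a to \<open>\<omega>\<^sub>\<lambda>(a, \<cdot>)\<close>.\<close>

definition form_nondegenerate ::
  "('k::field poly \<Rightarrow> 'a::ab_group_add \<Rightarrow> 'a) \<Rightarrow> ('a \<Rightarrow> 'a \<Rightarrow> 'k poly) \<Rightarrow> bool" where
  "form_nondegenerate scale \<omega> \<longleftrightarrow>
     module_hom scale dual_scale \<omega> \<and> bij_betw \<omega> UNIV (conformal_dual scale)"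

locale gen_pseudo_hessian_post_lie_conformal_algebra =
  post_lie_conformal_algebra scale br dot + conformal_form scale \<omega>
  for scale :: "'k::field_char_0 poly \<Rightarrow> 'a::ab_group_add \<Rightarrow> 'a"
    and br :: "'a \<Rightarrow> 'a \<Rightarrow> 'a poly"
    and dot :: "'a \<Rightarrow> 'a \<Rightarrow> 'a poly"
    and \<omega> :: "'a \<Rightarrow> 'a \<Rightarrow> 'k poly" +
  assumes nondegenerate: "form_nondegenerate scale \<omega>"
    and symmetric: "form_symmetric \<omega>"
    and invariant: "post_lie_invariant scale br dot \<omega>"

end

theory Submission
  imports Defs
begin

text \<open>
  Write \<open>a \<cdot>\<^sub>\<lambda> b = [B a \<^sub>\<lambda> b]\<close>. Everything rests on the Jacobi identity and on one consequence of
  skew-symmetry. Inside an expression that satisfies \<open>g(\<partial>x) = -L g(x)\<close>, such as \<open>[x \<^sub>L c]\<close> or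
  \<open>\<omega>\<^sub>L(x, c)\<close>, the operator \<open>\<partial>\<close> in \<open>[a \<^sub>M b] = -[b \<^sub>-\<^sub>M\<^sub>-\<^sub>\<partial> a]\<close> becomes \<open>-L\<close>, so that exchanging
  the arguments of the bracket replaces the parameter \<open>M\<close> by \<open>L - M\<close>
  (\<open>evalp_bracket_swap\<close>).

  The second post-Lie identity is the Jacobi identity for \<open>B a\<close>, \<open>b\<close>, \<open>c\<close>. In the first one, the
  three terms in which a product is multiplied with \<open>c\<close> at \<open>\<lambda> + \<mu>\<close> are
  \<open>[B[B a \<^sub>\<lambda> b] \<^sub>\<lambda>\<^sub>+\<^sub>\<mu> c]\<close>, \<open>-[B[B b \<^sub>\<mu> a] \<^sub>\<lambda>\<^sub>+\<^sub>\<mu> c]\<close> and \<open>[B[a \<^sub>\<lambda> b] \<^sub>\<lambda>\<^sub>+\<^sub>\<mu> c]\<close>. The swap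
  turns the middle one into \<open>[B[a \<^sub>\<lambda> B b] \<^sub>\<lambda>\<^sub>+\<^sub>\<mu> c]\<close>, and the Rota-Baxter identity of weight 1 collects the
  sum to \<open>[[B a \<^sub>\<lambda> B b] \<^sub>\<lambda>\<^sub>+\<^sub>\<mu> c]\<close>. What remains is the Jacobi identity for \<open>B a\<close>, \<open>B b\<close>, \<open>c\<close>
  (\<open>rota_baxter_post_lie\<close>).

  For a form \<open>\<omega>\<close> that is invariant on the Lie conformal algebra, the swap followed by invariance
  gives \<open>\<omega>\<^sub>\<lambda>\<^sub>+\<^sub>\<mu>([B a \<^sub>\<lambda> b], c) = -\<omega>\<^sub>\<mu>(b, [B a \<^sub>\<lambda> c])\<close>. This relation and the one with
  \<open>(a, \<lambda>)\<close> and \<open>(b, \<mu>)\<close> exchanged show that both sides of the invariance condition for the post-Lie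
  product are equal to the same sum (\<open>rota_baxter_invariant\<close>).

  Most of the work is to justify this calculus for polynomials with coefficients in a module.
  All composite products and forms are evaluations \<open>\<Sum>\<^sub>n M\<^sup>n g(p\<^sub>n)\<close> of the coefficients of a
  \<open>\<lambda>\<close>-product \<open>p\<close> under a linear map \<open>g\<close>. This turns identities about the extended products into
  statements about \<open>evalp\<close>.
\<close>

section \<open>Modules of polynomials with coefficients in a module\<close>

text \<open>Monomials and sums, rather than \<open>pCons\<close>, because the operations below are additive and
  have a closed form on monomials.\<close>

lemma poly_add_monom_induct [case_names monom add]:
  fixes p :: "'m::comm_monoid_add poly"
  assumes "\<And>a n. P (monom a n)" and "\<And>p q. P p \<Longrightarrow> P q \<Longrightarrow> P (p + q)"
  shows "P p"
proof -
  have "P (\<Sum>i\<in>I. monom (coeff p i) i)" if "finite I" for I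
    using that
  proof (induction I)
    case empty
    then show ?case using assms(1)[of 0 0] by simp
  qed (auto intro: assms)
  from this[of "{..degree p}"] show ?thesis
    by (simp add: poly_as_sum_of_monoms)
qed

text \<open>Common degree bounds allow sums of polynomials to be compared term by term.\<close>

lemma poly_scale_bounded:
  assumes "module s" "degree P \<le> m" "degree q \<le> n"
  shows "poly_scale s P q = (\<Sum>i\<le>m. \<Sum>j\<le>n. monom (s (coeff P i) (coeff q j)) (i + j))"
proof -
  interpret module s by fact
  have "poly_scale s P q = (\<Sum>i\<le>degree P. \<Sum>j\<le>n. monom (s (coeff P i) (coeff q j)) (i + j))"
    unfolding poly_scale_def
    by (intro sum.cong refl sum.mono_neutral_left)
      (use assms in \<open>auto simp: coeff_eq_0\<close>)
  also have "\<dots> = (\<Sum>i\<le>m. \<Sum>j\<le>n. monom (s (coeff P i) (coeff q j)) (i + j))"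
    by (intro sum.mono_neutral_left) (use assms in \<open>auto simp: coeff_eq_0\<close>)
  finally show ?thesis .
qed

lemma poly_scale_add_left:
  assumes "module s"
  shows "poly_scale s (P + Q) q = poly_scale s P q + poly_scale s Q q"
proof -
  interpret module s by fact
  let ?m = "max (degree P) (degree Q)"
  show ?thesis
    by (simp add: poly_scale_bounded[OF assms, of _ ?m _ "degree q"] degree_add_le
        scale_left_distrib add_monom[symmetric] sum.distrib)
qed

lemma poly_scale_add_right:
  assumes "module s"
  shows "poly_scale s P (p + q) = poly_scale s P p + poly_scale s P q"
proof -
  interpret module s by fact
  let ?n = "max (degree p) (degree q)"
  show ?thesis
    by (simp add: poly_scale_bounded[OF assms, of _ "degree P" _ ?n] degree_add_le
        scale_right_distrib add_monom[symmetric] sum.distrib)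
qed

lemma poly_scale_monom:
  assumes "module s"
  shows "poly_scale s (monom r i) (monom x j) = monom (s r x) (i + j)"
proof -
  interpret module s by fact
  have "poly_scale s (monom r i) (monom x j) =
      (\<Sum>k\<le>i. \<Sum>l\<le>j. if k = i then if l = j then monom (s r x) (i + j) else 0 else 0)"
    unfolding poly_scale_bounded[OF assms degree_monom_le degree_monom_le]
    by (intro sum.cong refl) auto
  also have "\<dots> = (\<Sum>k\<le>i. if k = i then monom (s r x) (i + j) else 0)"
    by (intro sum.cong refl) simp
  finally show ?thesis by simp
qed

text \<open>All three module laws are additive in every argument, hence reduce to monomials.\<close>

lemma module_poly_scale:
  assumes "module s"
  shows "module (poly_scale s)"
proof -
  interpret module s by fact
  have assoc: "poly_scale s P (poly_scale s Q p) = poly_scale s (P * Q) p" for P Q p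
  proof (induction P rule: poly_add_monom_induct)
    case P: (monom r i)
    show ?case
    proof (induction Q rule: poly_add_monom_induct)
      case Q: (monom t j)
      show ?case
        by (induction p rule: poly_add_monom_induct)
          (simp_all add: poly_scale_monom assms mult_monom poly_scale_add_right add.assoc)
    qed (simp add: assms poly_scale_add_right poly_scale_add_left distrib_left)
  qed (simp add: assms poly_scale_add_left distrib_right)
  have one: "poly_scale s 1 p = p" for p
    by (induction p rule: poly_add_monom_induct)
      (simp_all add: poly_scale_monom[OF assms, of 1 0, simplified monom_0 one_pCons[symmetric]]
        poly_scale_add_right assms)
  show ?thesis
    by unfold_locales (simp_all add: assms poly_scale_add_left poly_scale_add_right assoc one)
qed

lemma poly_scale_var:
  assumes "module s"
  shows "poly_scale s [:0, 1:] p = pCons 0 p"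
proof -
  interpret module s by fact
  show ?thesis
  proof (induction p rule: poly_add_monom_induct)
    case (monom a n)
    have "poly_scale s [:0, 1:] (monom a n) = monom a (Suc n)"
      using poly_scale_monom[OF assms, of 1 1 a n] by (simp add: monom_altdef monom_Suc)
    then show ?case by (simp add: monom_Suc)
  qed (simp add: poly_scale_add_right assms)
qed

lemma map_poly_additive:
  fixes f :: "'a::ab_group_add \<Rightarrow> 'b::ab_group_add"
  assumes "additive f"
  shows "map_poly f (p + q) = map_poly f p + map_poly f q"
  using assms by (intro poly_eqI) (simp add: coeff_map_poly additive.zero additive.add)

lemma poly_scale_const:
  assumes "module s"
  shows "poly_scale s [:r:] p = map_poly (s r) p"
proof -
  interpret module s by fact
  have *: "additive (s r)" by (simp add: additive_def scale_right_distrib)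
  show ?thesis
    by (induction p rule: poly_add_monom_induct)
      (simp_all add: poly_scale_monom[OF assms, of r 0, simplified monom_0] map_poly_monom
        poly_scale_add_right assms map_poly_additive *)
qed

section \<open>Evaluation of polynomials through an additive map\<close>

text \<open>The value at \<open>r\<close> of the polynomial whose coefficients are the \<open>g\<close>-images of those of \<open>p\<close>.
  Substitution for a variable and linear extension are both of this form, which is why the map
  \<open>g\<close> is kept as a separate argument.\<close>

definition evalp ::
  "('r::comm_ring_1 \<Rightarrow> 'n::ab_group_add \<Rightarrow> 'n) \<Rightarrow> ('m::zero \<Rightarrow> 'n) \<Rightarrow> 'r \<Rightarrow> 'm poly \<Rightarrow> 'n" where
  "evalp act g r p = (\<Sum>n\<le>degree p. act (r ^ n) (g (coeff p n)))"

lemma evalp_bounded: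
  fixes g :: "'m::ab_group_add \<Rightarrow> 'n::ab_group_add"
  assumes "module act" "additive g" "degree p \<le> n"
  shows "evalp act g r p = (\<Sum>i\<le>n. act (r ^ i) (g (coeff p i)))"
proof -
  interpret module act by fact
  show ?thesis unfolding evalp_def
    by (rule sum.mono_neutral_left)
      (use assms in \<open>auto simp: coeff_eq_0 additive.zero\<close>)
qed

lemma additive_evalp:
  fixes g :: "'m::ab_group_add \<Rightarrow> 'n::ab_group_add"
  assumes "module act" "additive g"
  shows "additive (evalp act g r)"
proof
  fix p q :: "'m poly"
  interpret module act by fact
  let ?n = "max (degree p) (degree q)"
  show "evalp act g r (p + q) = evalp act g r p + evalp act g r q"
    by (simp add: evalp_bounded[OF assms, of _ ?n] degree_add_le additive.add[OF assms(2)]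
        scale_right_distrib sum.distrib)
qed

lemma evalp_monom:
  fixes g :: "'m::ab_group_add \<Rightarrow> 'n::ab_group_add"
  assumes "module act" "additive g"
  shows "evalp act g r (monom a n) = act (r ^ n) (g a)"
proof -
  interpret module act by fact
  have "evalp act g r (monom a n) = (\<Sum>i\<le>n. if i = n then act (r ^ n) (g a) else 0)"
    unfolding evalp_bounded[OF assms degree_monom_le]
    by (intro sum.cong) (auto simp: additive.zero[OF assms(2)])
  then show ?thesis by simp
qed

lemma evalp_const:
  assumes "module act"
  shows "evalp act g r [:a:] = g a"
proof -
  interpret module act by fact
  show ?thesis by (simp add: evalp_def)
qed

lemma evalp_pCons_0:
  fixes g :: "'m::ab_group_add \<Rightarrow> 'n::ab_group_add"
  assumes "module act" "additive g"
  shows "evalp act g r (pCons 0 p) = act r (evalp act g r p)"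
proof -
  interpret module act by fact
  show ?thesis
  proof (induction p rule: poly_add_monom_induct)
    case (monom a n)
    show ?case using assms by (simp add: monom_Suc[symmetric] evalp_monom)
  next
    case (add p q)
    have "pCons 0 (p + q) = pCons 0 p + pCons 0 q" by simp
    then show ?case
      using add by (simp only: additive.add[OF additive_evalp[OF assms]] scale_right_distrib)
  qed
qed

lemma evalp_map_poly:
  fixes g :: "'m::ab_group_add \<Rightarrow> 'n::ab_group_add"
  assumes "module act" "additive g" "additive h"
  shows "evalp act g r (map_poly h p) = evalp act (\<lambda>x. g (h x)) r p"
proof -
  have gh: "additive (\<lambda>x. g (h x))"
    using assms(2,3) by (simp add: additive_def)
  have "degree (map_poly h p) \<le> degree p" 
    by (rule degree_le) (simp add: coeff_map_poly additive.zero[OF assms(3)] coeff_eq_0)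
  then show ?thesis
    by (simp add: evalp_bounded[OF assms(1,2), of _ "degree p"]
        evalp_bounded[OF assms(1) gh, of _ "degree p"] coeff_map_poly additive.zero[OF assms(3)])
qed

lemma evalp_act:
  fixes g :: "'m::ab_group_add \<Rightarrow> 'n::ab_group_add"
  assumes "module act"
  shows "evalp act (\<lambda>x. act t (g x)) r p = act t (evalp act g r p)"
proof -
  interpret module act by fact
  show ?thesis by (simp add: evalp_def scale_sum_right mult.commute)
qed


section \<open>Extension of scalars to two variables\<close>

lemma module_times: "module ((*) :: 'r::comm_ring_1 \<Rightarrow> 'r \<Rightarrow> 'r)"
  by unfold_locales (simp_all add: algebra_simps)

lemma module_const_scale:
  assumes "module scale"
  shows "module (const_scale scale)"
proof -
  interpret module scale by fact
  show ?thesis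
  proof
    fix c d x y
    show "const_scale scale (c + d) x = const_scale scale c x + const_scale scale d x"
      by (simp add: const_scale_def flip: scale_left_distrib)
  qed (simp_all add: const_scale_def scale_right_distrib one_pCons[symmetric] mult.commute)
qed

lemma module_scale2: "module scale \<Longrightarrow> module (scale2 scale)"
  unfolding scale2_def by (intro module_poly_scale module_const_scale)

lemma additive_cst: "additive cst"
  by unfold_locales simp

lemma subst2_eq_evalp: "subst2 act L = evalp act cst L"
  by (simp add: fun_eq_iff subst2_def evalp_def)

text \<open>Linear extension to two variables is evaluation in one variable at a time.\<close>

lemma lin_ext2_eq_evalp:
  assumes "module act"
  shows "lin_ext2 act g u = evalp act (evalp act g lam) mu u"
proof -
  interpret module act by fact
  show ?thesis by (simp add: lin_ext2_def evalp_def scale_sum_right mult.commute)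
qed

lemma lin_ext2_cst: "module act \<Longrightarrow> lin_ext2 act g (cst a) = g a"
  by (simp add: lin_ext2_eq_evalp evalp_const)

lemma additive_lin_ext2:
  fixes g :: "'a::ab_group_add \<Rightarrow> 'm::ab_group_add poly poly"
  assumes "module act" "additive g"
  shows "additive (lin_ext2 act g)"
proof -
  have "lin_ext2 act g = evalp act (evalp act g lam) mu"
    using assms by (simp add: fun_eq_iff lin_ext2_eq_evalp)
  then show ?thesis using assms by (simp add: additive_evalp)
qed

lemma monom_eq_lam_mu:
  fixes c :: "'k::comm_ring_1"
  shows "monom (monom c i) j = lam ^ i * mu ^ j * cst c"
proof -
  have "(lam :: 'k poly poly) ^ i = [:[:0, 1:] ^ i:]"
    by (induction i) (simp_all add: lam_def one_pCons)
  then show ?thesis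
    by (simp add: mu_def monom_altdef ac_simps)
qed

text \<open>Every \<open>P\<close> is a sum of terms \<open>c \<lambda>\<^sup>i \<mu>\<^sup>j\<close>. The extension respects the powers of the
  variables by construction and the scalars \<open>c\<close> by linearity of \<open>g\<close>.\<close>

lemma lin_ext2_scale2_cst:
  fixes g :: "'a::ab_group_add \<Rightarrow> 'm::ab_group_add poly poly"
  assumes scale: "module scale" and act: "module act" and g: "additive g"
    and linear: "\<And>c x. g (const_scale scale c x) = act (cst c) (g x)"
  shows "lin_ext2 act g (scale2 scale P (cst x)) = act P (g x)"
proof -
  interpret scale2: module "scale2 scale" by (rule module_scale2[OF scale])
  interpret act: module act by fact
  note add = additive.add[OF additive_lin_ext2[OF act g]]
  show ?thesis
  proof (induction P rule: poly_add_monom_induct)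
    case outer: (monom p j)
    show ?case
    proof (induction p rule: poly_add_monom_induct)
      case inner: (monom c i)
      have "scale2 scale (monom (monom c i) j) (monom (monom x 0) 0)
          = monom (monom (const_scale scale c x) i) j"
        by (simp only: scale2_def poly_scale_monom module_poly_scale module_const_scale scale add_0_right)
      then have "lin_ext2 act g (scale2 scale (monom (monom c i) j) (cst x))
          = act (mu ^ j) (act (lam ^ i) (g (const_scale scale c x)))"
        by (simp add: monom_0 lin_ext2_eq_evalp evalp_monom additive_evalp act g)
      also have "\<dots> = act (monom (monom c i) j) (g x)"
        by (simp add: linear monom_eq_lam_mu ac_simps)
      finally show ?case .
    next
      case inner: (add p q)
      then show ?case
        by (simp add: add_monom[symmetric] scale2.scale_left_distrib act.scale_left_distrib add)
    qed
  qed (simp add: scale2.scale_left_distrib act.scale_left_distrib add)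
qed

text \<open>This evaluates nested products: \<open>M\<close> passes through the linear extension.\<close>

lemma lin_ext2_subst2:
  fixes g :: "'a::ab_group_add \<Rightarrow> 'm::ab_group_add poly poly"
  assumes "module scale" "module act" "additive g"
    and "\<And>c x. g (const_scale scale c x) = act (cst c) (g x)"
  shows "lin_ext2 act g (subst2 (scale2 scale) M p) = evalp act g M p"
  by (simp add: subst2_def evalp_def additive.sum[OF additive_lin_ext2] assms lin_ext2_scale2_cst)

lemma ext2_cst_left:
  "module act \<Longrightarrow> ext2 act f L (cst a) v = lin_ext2 act (\<lambda>b. subst2 act L (f a b)) v"
  by (simp add: ext2_def lin_ext2_cst)

lemma ext2_cst_right:
  "module act \<Longrightarrow> ext2 act f L u (cst b) = lin_ext2 act (\<lambda>a. subst2 act L (f a b)) u"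
  by (simp add: ext2_def lin_ext2_cst)

lemma ext2_cst_cst: "module act \<Longrightarrow> ext2 act f L (cst a) (cst b) = subst2 act L (f a b)"
  by (simp add: ext2_def lin_ext2_cst)

text \<open>The operator \<open>-\<lambda> - \<partial>\<close> becomes \<open>-M + L\<close> under \<open>g\<close>, since \<open>\<lambda>\<close> is evaluated at \<open>M\<close>
  and \<open>g\<close> turns \<open>\<partial>\<close> into \<open>-L\<close>.\<close>

lemma evalp_subst_op:
  fixes g :: "'a::ab_group_add \<Rightarrow> 'n::ab_group_add"
  assumes scale: "module scale" and act: "module act" and g: "additive g"
    and del: "\<And>x. g (scale [:0, 1:] x) = act (- L) (g x)"
  shows "evalp act g M (subst_op scale (- lam1 - del1) p) = evalp act g (L - M) p"
proof -
  interpret scale: module scale by fact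
  interpret act: module act by fact
  interpret poly: module "poly_scale scale" by (rule module_poly_scale[OF scale])
  interpret evalp: additive "evalp act g M" by (rule additive_evalp[OF act g])
  have additive_scale: "additive (scale r)" for r
    by (simp add: additive_def scale.scale_right_distrib)
  have step: "evalp act g M (poly_scale scale (- lam1 - del1) q) = act (L - M) (evalp act g M q)" for q
  proof -
    have "poly_scale scale (- lam1 - del1) q = - pCons 0 q - map_poly (scale [:0, 1:]) q"
      by (simp only: poly.scale_left_diff_distrib poly.scale_minus_left lam1_def del1_def
          poly_scale_var poly_scale_const scale)
    moreover have "evalp act g M (map_poly (scale [:0, 1:]) q) = act (- L) (evalp act g M q)"
      by (simp only: evalp_map_poly[OF act g additive_scale] del evalp_act[OF act])
    ultimately show ?thesis
      by (simp add: evalp.diff evalp.minus evalp_pCons_0 act g act.scale_left_diff_distrib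
          del: minus_pCons)
  qed
  have power: "evalp act g M (poly_scale scale ((- lam1 - del1) ^ n) q) = act ((L - M) ^ n) (evalp act g M q)" for n q
  proof (induction n)
    case (Suc n)
    then show ?case by (simp add: step flip: poly.scale_scale act.scale_scale)
  qed simp
  show ?thesis
    by (simp add: subst_op_def evalp.sum power evalp_const act) (simp add: evalp_def)
qed

section \<open>Nested products and forms\<close>

text \<open>Common ground of conformal products, with values in \<open>A[\<lambda>]\<close>, and conformal forms, with values
  in \<open>k[\<lambda>]\<close>: bilinear maps into \<open>M[\<lambda>]\<close> that are sesquilinear in the first argument.
  The two notions differ in the second argument, where \<open>\<partial>\<close> becomes \<open>\<lambda> + \<partial>\<close> for products
  and \<open>\<lambda>\<close> for forms.\<close>

locale lambda_pairing = scale: module scale + act: module act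
  for scale :: "'k::field poly \<Rightarrow> 'a::ab_group_add \<Rightarrow> 'a"
    and act :: "'k poly poly \<Rightarrow> 'm::ab_group_add poly poly \<Rightarrow> 'm poly poly" +
  fixes s :: "'k \<Rightarrow> 'm \<Rightarrow> 'm" and f :: "'a \<Rightarrow> 'a \<Rightarrow> 'm poly"
  assumes module_s: "module s"
    and cst_scale: "cst (s c y) = act (cst c) (cst y)"
    and pairing_bilinear: "k_bilinear (const_scale scale) (\<lambda>c. map_poly (s c)) f"
    and pairing_del_left: "f (scale [:0, 1:] a) b = - pCons 0 (f a b)"
begin

abbreviation pair_at :: "'k poly poly \<Rightarrow> 'a \<Rightarrow> 'a \<Rightarrow> 'm poly poly" where
  "pair_at L a b \<equiv> subst2 act L (f a b)"

lemma additive_subst2: "additive (subst2 act L)"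
  unfolding subst2_eq_evalp by (intro additive_evalp additive_cst act.module_axioms)

lemma pair_at_additive: "additive (\<lambda>a. pair_at L a b)" "additive (pair_at L a)"
  using pairing_bilinear additive.add[OF additive_subst2]
  by (auto simp: k_bilinear_def Vector_Spaces.linear_iff additive_def)

lemma subst2_map_poly: "subst2 act L (map_poly (s c) p) = act (cst c) (subst2 act L p)"
proof -
  have "additive (s c)" using module_s by (simp add: module_def additive_def)
  then show ?thesis
    unfolding subst2_eq_evalp
    by (simp only: evalp_map_poly[OF act.module_axioms additive_cst] cst_scale
        evalp_act[OF act.module_axioms])
qed

lemma pair_at_scale:
  "pair_at L (const_scale scale c a) b = act (cst c) (pair_at L a b)"
  "pair_at L a (const_scale scale c b) = act (cst c) (pair_at L a b)"
  using pairing_bilinear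
  by (auto simp: k_bilinear_def Vector_Spaces.linear_iff subst2_map_poly)

lemma pair_at_del_left: "pair_at L (scale [:0, 1:] a) b = act (- L) (pair_at L a b)"
  using additive.minus[OF additive_subst2]
  by (simp add: pairing_del_left subst2_eq_evalp evalp_pCons_0 act.module_axioms additive_cst
      act.scale_minus_left del: minus_pCons)

text \<open>With the outer product written as the linear map \<open>x \<mapsto> f\<^sub>L(x, c)\<close> or \<open>x \<mapsto> f\<^sub>L(a, x)\<close>,
  a nested product becomes an evaluation of the inner product \<open>h\<close> through this map.\<close>

lemma ext2_nested_left:
  "ext2 act f L (ext_prod scale h M (cst a) (cst b)) (cst c) = evalp act (\<lambda>x. pair_at L x c) M (h a b)"
  unfolding ext2_cst_cst[OF module_scale2[OF scale.module_axioms]] ext2_cst_right[OF act.module_axioms]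
  by (intro lin_ext2_subst2 scale.module_axioms act.module_axioms pair_at_additive pair_at_scale)

lemma ext2_nested_right:
  "ext2 act f L (cst a) (ext_prod scale h M (cst b) (cst c)) = evalp act (pair_at L a) M (h b c)"
  unfolding ext2_cst_cst[OF module_scale2[OF scale.module_axioms]] ext2_cst_left[OF act.module_axioms]
  by (intro lin_ext2_subst2 scale.module_axioms act.module_axioms pair_at_additive pair_at_scale)

end

lemma (in conformal_product) lambda_pairing:
  "lambda_pairing scale (scale2 scale) (const_scale scale) f"
proof -
  interpret const: module "const_scale scale" by (rule module_const_scale) (rule module_axioms)
  interpret poly: module "poly_scale scale" by (rule module_poly_scale) (rule module_axioms)
  interpret scale2: module "scale2 scale" by (rule module_scale2) (rule module_axioms)
  have "cst (const_scale scale c y) = scale2 scale (cst c) (cst y)" for c y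
    by (simp add: scale2_def poly_scale_const module_poly_scale const.module_axioms map_poly_pCons)
  moreover have "f (scale [:0, 1:] a) b = - pCons 0 (f a b)" for a b
    by (simp add: sesquilinear_left lam1_def poly.scale_minus_left poly_scale_var module_axioms del: minus_pCons)
  ultimately show ?thesis
    by unfold_locales (use bilinear in auto)
qed

lemma (in conformal_form) lambda_pairing: "lambda_pairing scale (*) (*) \<omega>"
proof -
  interpret times: module "(*) :: 'k poly poly \<Rightarrow> _" by (rule module_times)
  have "(\<lambda>c. map_poly ((*) c)) = (smult :: 'k \<Rightarrow> _)"
    by (simp add: fun_eq_iff smult_conv_map_poly)
  then show ?thesis
    by unfold_locales (use form_bilinear form_left in \<open>simp_all add: algebra_simps\<close>)
qed

text \<open>Skew-symmetry in the form in which it is applied: within \<open>g\<close>, exchanging the arguments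
  replaces the parameter \<open>M\<close> by \<open>L - M\<close>.\<close>

lemma (in lie_conformal_algebra) evalp_bracket_swap:
  fixes g :: "'a \<Rightarrow> 'n::ab_group_add"
  assumes "module act" "additive g" "\<And>x. g (scale [:0, 1:] x) = act (- L) (g x)"
  shows "evalp act g M (br a b) = - evalp act g (L - M) (br b a)"
  by (subst skew_symmetry)
    (simp add: additive.minus[OF additive_evalp] assms evalp_subst_op module_axioms)

section \<open>Invariance of a form for arbitrary parameters\<close>

text \<open>The endomorphism of the \<open>k\<close>-algebra \<open>k[\<lambda>,\<mu>]\<close> with \<open>\<lambda> \<mapsto> L\<close> and \<open>\<mu> \<mapsto> M\<close>.\<close>

definition subst_vars :: "'k::comm_ring_1 poly poly \<Rightarrow> 'k poly poly \<Rightarrow> 'k poly poly \<Rightarrow> 'k poly poly" where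
  "subst_vars L M = evalp (*) (evalp (*) cst L) M"

lemma additive_subst_vars: "additive (subst_vars L M)"
  unfolding subst_vars_def by (intro additive_evalp module_times additive_cst)

lemma subst_vars_monom: "subst_vars L M (monom (monom c i) j) = M ^ j * (L ^ i * cst c)"
  by (simp add: subst_vars_def evalp_monom additive_evalp module_times additive_cst)

lemma subst_vars_mult: "subst_vars L M (P * Q) = subst_vars L M P * subst_vars L M Q"
proof -
  note add = additive.add[OF additive_subst_vars]
  have monoms: "subst_vars L M (monom (monom c i) j * Q) = subst_vars L M (monom (monom c i) j) * subst_vars L M Q"
    for c i j
  proof (induction Q rule: poly_add_monom_induct)
    case (monom q l)
    show ?case
    proof (induction q rule: poly_add_monom_induct)
      case (monom d k)
      have "cst (c * d) = cst c * cst d" by simp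
      then show ?case
        by (simp only: mult_monom subst_vars_monom power_add ac_simps)
    qed (simp add: add_monom[symmetric] add distrib_left)
  qed (simp add: add distrib_left)
  show ?thesis
  proof (induction P rule: poly_add_monom_induct)
    case (monom p j)
    show ?case
      by (induction p rule: poly_add_monom_induct)
        (simp_all add: add_monom[symmetric] add distrib_right monoms)
  qed (simp add: add distrib_right)
qed

lemma subst_vars_cst: "subst_vars L M (cst c) = cst c"
  using subst_vars_monom[of L M c 0 0] by (simp add: monom_0)

lemma subst_vars_lam: "subst_vars L M lam = L"
  using subst_vars_monom[of L M 1 1 0] by (simp add: monom_0 lam_def monom_altdef one_pCons[symmetric])

lemma subst_vars_mu: "subst_vars L M mu = M"
  using subst_vars_monom[of L M 1 0 1] by (simp add: monom_0 mu_def monom_altdef one_pCons[symmetric])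

lemma subst_vars_power: "subst_vars L M (P ^ n) = subst_vars L M P ^ n"
  using subst_vars_cst[of L M 1]
  by (induction n) (simp_all add: subst_vars_mult one_pCons[symmetric])

lemma subst_vars_evalp:
  "subst_vars L M (evalp (*) g r p) = evalp (*) (\<lambda>x. subst_vars L M (g x)) (subst_vars L M r) p"
  by (simp add: evalp_def additive.sum[OF additive_subst_vars] subst_vars_mult subst_vars_power)

text \<open>Invariance is an identity in \<open>k[\<lambda>,\<mu>]\<close>, so it survives the substitution
  of \<open>L\<close> for \<open>\<lambda>\<close> and \<open>M\<close> for \<open>\<mu>\<close>.\<close>

lemma (in conformal_form) lie_invariant_subst:
  assumes "lie_invariant scale br \<omega>"
  shows "ext_form \<omega> L (ext_prod scale br M (cst a) (cst b)) (cst c) =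
    ext_form \<omega> M (cst a) (ext_prod scale br (L - M) (cst b) (cst c))"
proof -
  interpret \<omega>: lambda_pairing scale "(*)" "(*)" \<omega> by (rule lambda_pairing)
  have "evalp (*) (\<lambda>x. \<omega>.pair_at lam x c) mu (br a b) = evalp (*) (\<omega>.pair_at mu a) (lam - mu) (br b c)"
    using assms by (simp only: lie_invariant_def \<omega>.ext2_nested_left \<omega>.ext2_nested_right)
  from arg_cong[OF this, of "subst_vars L M"] show ?thesis
    by (simp add: \<omega>.ext2_nested_left \<omega>.ext2_nested_right subst2_eq_evalp subst_vars_evalp
        subst_vars_cst subst_vars_lam subst_vars_mu additive.diff[OF additive_subst_vars])
qed

section \<open>The product induced by a Rota-Baxter operator\<close>

context rota_baxter_lie_conformal_algebra
begin

lemma B_additive: "additive B"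
  using B_hom by (simp add: additive_def module_hom_iff)

lemma B_scale: "B (scale P a) = scale P (B a)"
  using B_hom by (simp add: module_hom_iff)

lemma conformal_product_B: "conformal_product scale (\<lambda>a b. br (B a) b)"
proof unfold_locales
  have "Vector_Spaces.linear (const_scale scale) (const_scale scale) B"
    using bilinear B_additive
    by (auto simp: k_bilinear_def Vector_Spaces.linear_iff additive_def const_scale_def B_scale)
  from Vector_Spaces.linear_compose[OF this]
  show "k_bilinear (const_scale scale) (\<lambda>c. map_poly (const_scale scale c)) (\<lambda>a b. br (B a) b)"
    using bilinear unfolding k_bilinear_def o_def by blast
qed (simp_all add: B_scale sesquilinear_left sesquilinear_right)

lemma ext_prod_B: "ext_prod scale (\<lambda>a b. br (B a) b) L (cst a) v = ext_prod scale br L (cst (B a)) v"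
  by (simp add: ext2_cst_left module_scale2 module_axioms)

lemma ext_prod_nested_B:
  "ext_prod scale (\<lambda>a b. br (B a) b) L (ext_prod scale h M (cst a) (cst b)) (cst c) =
    evalp (scale2 scale) (\<lambda>x. subst2 (scale2 scale) L (br (B x) c)) M (h a b)"
proof -
  interpret conformal_product scale "\<lambda>a b. br (B a) b" by (rule conformal_product_B)
  show ?thesis by (rule lambda_pairing.ext2_nested_left[OF lambda_pairing])
qed

end

lemma rota_baxter_post_lie:
  assumes "rota_baxter_lie_conformal_algebra scale br 1 B"
  shows "post_lie_conformal_algebra scale br (\<lambda>a b. br (B a) b)"
proof -
  interpret rota_baxter_lie_conformal_algebra scale br 1 B by fact
  interpret dot: conformal_product scale "\<lambda>a b. br (B a) b" by (rule conformal_product_B)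
  interpret br: lambda_pairing scale "scale2 scale" "const_scale scale" br by (rule lambda_pairing)
  interpret dot: lambda_pairing scale "scale2 scale" "const_scale scale" "\<lambda>a b. br (B a) b"
    by (rule dot.lambda_pairing)
  let ?dot = "\<lambda>a b. br (B a) b"
  show ?thesis
  proof unfold_locales
    fix a b c
    let ?ev = "evalp (scale2 scale) (\<lambda>x. dot.pair_at (lam + mu) x c)"
    interpret ev: additive "?ev lam"
      by (intro additive_evalp br.act.module_axioms dot.pair_at_additive)
    \<comment> \<open>\<open>?ev\<close> turns \<open>\<partial>\<close> into \<open>-(\<lambda> + \<mu>)\<close>, so the swap takes the parameter \<open>\<mu>\<close> to \<open>\<lambda>\<close>.\<close>
    have "?ev mu (br (B b) a) = - ?ev (lam + mu - mu) (br a (B b))"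
      by (intro evalp_bracket_swap br.act.module_axioms dot.pair_at_additive dot.pair_at_del_left)
    then have "?ev lam (br (B a) b) - ?ev mu (br (B b) a) + ?ev lam (br a b)
        = ?ev lam (br (B a) b + br a (B b) + br a b)"
      by (simp add: ev.add)
    also have "\<dots> = evalp (scale2 scale) (\<lambda>x. br.pair_at (lam + mu) x c) lam
        (map_poly B (br (B a) b + br a (B b) + br a b))"
      by (simp add: evalp_map_poly br.act.module_axioms br.pair_at_additive B_additive)
    also have "map_poly B (br (B a) b + br a (B b) + br a b) = br (B a) (B b)"
    proof -
      have "const_scale scale 1 = id"
        by (simp add: fun_eq_iff const_scale_def one_pCons[symmetric])
      then show ?thesis using rota_baxter[of a b] by simp
    qed
    also have "evalp (scale2 scale) (\<lambda>x. br.pair_at (lam + mu) x c) lam (br (B a) (B b)) =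
        ext_prod scale br (lam + mu) (ext_prod scale br lam (cst (B a)) (cst (B b))) (cst c)"
      by (rule br.ext2_nested_left[symmetric])
    finally show "ext_prod scale ?dot (lam + mu) (ext_prod scale ?dot lam (cst a) (cst b)) (cst c)
       - ext_prod scale ?dot (lam + mu) (ext_prod scale ?dot mu (cst b) (cst a)) (cst c)
       + ext_prod scale ?dot (lam + mu) (ext_prod scale br lam (cst a) (cst b)) (cst c)
       + ext_prod scale ?dot mu (cst b) (ext_prod scale ?dot lam (cst a) (cst c))
       - ext_prod scale ?dot lam (cst a) (ext_prod scale ?dot mu (cst b) (cst c)) = 0"
      using jacobi[of "B a" "B b" c] by (simp add: ext_prod_nested_B ext_prod_B)
    show "ext_prod scale ?dot lam (cst a) (ext_prod scale br mu (cst b) (cst c)) =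
         ext_prod scale br (lam + mu) (ext_prod scale ?dot lam (cst a) (cst b)) (cst c)
         + ext_prod scale br mu (cst b) (ext_prod scale ?dot lam (cst a) (cst c))"
      unfolding ext_prod_B by (rule jacobi)
  qed
qed

text \<open>By skew-adjointness of the operators \<open>b \<mapsto> [B a \<^sub>\<lambda> b]\<close>, each term at \<open>\<lambda> + \<mu>\<close> is
  equal, sign included, to the subtracted term on the opposite side of the invariance condition.\<close>

lemma rota_baxter_invariant:
  assumes rb: "rota_baxter_lie_conformal_algebra scale br \<theta> B"
    and form: "conformal_form scale \<omega>" and inv: "lie_invariant scale br \<omega>"
  shows "post_lie_invariant scale br (\<lambda>a b. br (B a) b) \<omega>"
proof -
  interpret rota_baxter_lie_conformal_algebra scale br \<theta> B by fact
  interpret form: conformal_form scale \<omega> by fact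
  interpret \<omega>: lambda_pairing scale "(*)" "(*)" \<omega> by (rule form.lambda_pairing)
  \<comment> \<open>Skew-adjointness. In the goal \<open>L = \<lambda> + \<mu>\<close> and \<open>M\<close> is \<open>\<lambda>\<close> or \<open>\<mu>\<close>.\<close>
  have swap: "ext_form \<omega> L (ext_prod scale br M (cst (B a)) (cst b)) (cst c) =
      - ext_form \<omega> (L - M) (cst b) (ext_prod scale br M (cst (B a)) (cst c))" for L M a b c
  proof -
    have "ext_form \<omega> L (ext_prod scale br M (cst (B a)) (cst b)) (cst c) =
        - ext_form \<omega> L (ext_prod scale br (L - M) (cst b) (cst (B a))) (cst c)"
      unfolding \<omega>.ext2_nested_left
      by (intro evalp_bracket_swap module_times \<omega>.pair_at_additive \<omega>.pair_at_del_left)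
    then show ?thesis by (simp add: form.lie_invariant_subst[OF inv])
  qed
  show ?thesis
    using inv by (simp add: post_lie_invariant_def ext_prod_B swap)
qed

theorem proposition3p33:
  fixes scale :: "'k::field_char_0 poly \<Rightarrow> 'a::ab_group_add \<Rightarrow> 'a"
    and br dot :: "'a \<Rightarrow> 'a \<Rightarrow> 'a poly"
    and B :: "'a \<Rightarrow> 'a"
  assumes "rota_baxter_lie_conformal_algebra scale br 1 B"
    and "\<And>a b. dot a b = br (B a) b"
  shows "post_lie_conformal_algebra scale br dot \<and>
    (\<forall>\<omega>. conformal_form scale \<omega> \<and> form_nondegenerate scale \<omega> \<and> form_symmetric \<omega> \<and>
          lie_invariant scale br \<omega> \<longrightarrow>
          gen_pseudo_hessian_post_lie_conformal_algebra scale br dot \<omega>)"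
proof -
  have dot: "dot = (\<lambda>a b. br (B a) b)" using assms(2) by (simp add: fun_eq_iff)
  show ?thesis
    unfolding dot gen_pseudo_hessian_post_lie_conformal_algebra_def
      gen_pseudo_hessian_post_lie_conformal_algebra_axioms_def
    using rota_baxter_post_lie[OF assms(1)] rota_baxter_invariant[OF assms(1)] by blast
qed

end
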